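(* For each pair of reals $c_{\rm deg}, c_{\rm ind}$ with $1/2 \leq c_{\rm deg} < 1$ and $0 < c_{\rm ind} \leq 1-c_{\rm deg}$ set $$ k(c_{\rm ind},c_{\rm deg}) = \begin{cases} \left(1+\frac{1-c_{\rm deg}}{c_{\rm ind}}\right)^{c_{\rm ind}} & \text{if } \frac{1-c_{\rm deg}}{c_{\rm ind}} \in \mathbb{N},\\ \left(1+\left\lfloor \frac{1-c_{\rm deg}}{c_{\rm ind}} \right\rfloor \right)^{c_{\rm ind}\left\lceil \frac{1-c_{\rm deg}}{c_{\rm ind}} \right\rceil-1+c_{\rm deg}} \left(1+\left\lceil \frac{1-c_{\rm deg}}{c_{\rm ind}} \right\rceil \right)^{1-c_{\rm deg}-c_{\rm ind}\left\lfloor \frac{1-c_{\rm deg}}{c_{\rm ind}}\right\rfloor} & \text{otherwise.} \end{cases} $$ Then for each such pair the following two statements hold. (UB3) Let $N \subseteq \mathbb{N}$ be an infinite set, and let $\{(n,d_n,\alpha_n): n \in N\}$ be a sequence of triples of positive integers with (Q1) $d_n/n \rightarrow c_{\rm deg}$ as $n \rightarrow \infty$ and (Q2) $\alpha_n/n \rightarrow c_{\rm ind}$ as $n \rightarrow \infty$. If $(G_n)_{n \in N}$ is a sequence of graphs with $G_n$ an $(n,d_n,\alpha_n)$-graph for each $n \in N$, then $$ i(G_n) \leq k(c_{\rm ind},c_{\rm deg})^{n(1+o(1))}, $$ where $o(1) \rightarrow 0$ as $n, d_n \rightarrow \infty$. (LB3) There are an infinite set $N \subseteq \mathbb{N}$,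 a sequence of triples of positive integers $\{(n,d_n,\alpha_n): n \in N\}$ satisfying (Q1) $d_n/n \to c_{\rm deg}$ and (Q2) $\alpha_n/n \to c_{\rm ind}$ as $n \to \infty$, and a sequence of graphs $(G_n)_{n \in N}$ with $G_n$ an $(n,d_n,\alpha_n)$-graph for each $n \in N$, such that $$ i(G_n) \geq k(c_{\rm ind},c_{\rm deg})^{n(1+o(1))}, $$ where $o(1) \rightarrow 0$ as $n, d_n \rightarrow \infty$.
   Context: Graphs are finite and simple. $i(G)$ denotes the number of independent sets (sets of mutually non-adjacent vertices, including the empty set) of a graph $G$. An $(n,d,\alpha)$-graph is a $d$-regular graph on $n$ vertices whose largest independent set has size at most $\alpha$. All limits are taken along $n \in N$ (note that (Q1) forces $d_n \to \infty$). *)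

theory Defs
  imports Complex_Main "Graph_Theory.Pair_Digraph"
begin

text \<open>
  Finite simple graphs are modelled by the locale predicate \<open>pair_graph\<close>: a finite vertex set
  \<open>pverts G\<close> together with a symmetric, loop-free set \<open>parcs G\<close> of ordered pairs, so that an
  undirected edge \<open>uv\<close> appears as the two arcs \<open>(u, v)\<close> and \<open>(v, u)\<close>, and the degree
  of a vertex is its out-degree.
\<close>

definition indep_sets :: "'a pair_pre_digraph \<Rightarrow> 'a set set" where
  "indep_sets G = {S. S \<subseteq> pverts G \<and> (\<forall>u\<in>S. \<forall>v\<in>S. (u, v) \<notin> parcs G)}"

definition num_indep_sets :: "'a pair_pre_digraph \<Rightarrow> nat" where
  "num_indep_sets G = card (indep_sets G)"

definition independence_number :: "'a pair_pre_digraph \<Rightarrow> nat" where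
  "independence_number G = Max (card ` indep_sets G)"

definition nda_graph :: "nat \<Rightarrow> nat \<Rightarrow> nat \<Rightarrow> 'a pair_pre_digraph \<Rightarrow> bool" where
  "nda_graph n d \<alpha> G \<longleftrightarrow>
     pair_graph G \<and> card (pverts G) = n \<and>
     (\<forall>v\<in>pverts G. out_degree (with_proj G) v = d) \<and>
     independence_number G \<le> \<alpha>"

text \<open>The filter of the limits \<open>n \<rightarrow> \<infinity>\<close> with \<open>n\<close> restricted to \<open>N\<close>.\<close>

definition along :: "nat set \<Rightarrow> nat filter" where
  "along N = inf sequentially (principal N)"

text \<open>
  Families indexed by \<open>N\<close> are given as total functions on the natural numbers; their values
  outside \<open>N\<close> are irrelevant.
\<close>

definition nda_sequence ::
  "real \<Rightarrow> real \<Rightarrow> nat set \<Rightarrow> (nat \<Rightarrow> nat) \<Rightarrow> (nat \<Rightarrow> nat) \<Rightarrow> (nat \<Rightarrow> 'a pair_pre_digraph) \<Rightarrow> bool"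
where
  "nda_sequence c_ind c_deg N d \<alpha> G \<longleftrightarrow>
     infinite N \<and>
     (\<forall>n\<in>N. 0 < n \<and> 0 < d n \<and> 0 < \<alpha> n) \<and>
     ((\<lambda>n. real (d n) / real n) \<longlongrightarrow> c_deg) (along N) \<and>
     ((\<lambda>n. real (\<alpha> n) / real n) \<longlongrightarrow> c_ind) (along N) \<and>
     (\<forall>n\<in>N. nda_graph n (d n) (\<alpha> n) (G n))"

definition k_const :: "real \<Rightarrow> real \<Rightarrow> real" where
  "k_const c_ind c_deg =
     (let q = (1 - c_deg) / c_ind in
      if q \<in> \<nat> then (1 + q) powr c_ind
      else (1 + real_of_int \<lfloor>q\<rfloor>) powr (c_ind * real_of_int \<lceil>q\<rceil> - 1 + c_deg)
           * (1 + real_of_int \<lceil>q\<rceil>) powr (1 - c_deg - c_ind * real_of_int \<lfloor>q\<rfloor>))"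

end

theory Submission
  imports Defs
begin

text \<open>
  Both bounds rest on the same picture: up to a factor subexponential in \<open>n\<close>, the independent sets of a
  \<open>d\<close>-regular graph of order \<open>n\<close> live on \<open>n - d\<close> vertices, and there the best one can do with
  independence number \<open>\<alpha>\<close> is a disjoint union of \<open>\<alpha>\<close> cliques of sizes as equal as possible. A clique of
  size \<open>s\<close> has \<open>s + 1\<close> independent sets, and \<open>k\<^sup>n\<close> is the resulting product.

  Upper bound. A non-empty independent set lies in the set of non-neighbours of any of its members, so
  at most \<open>n + 1\<close> times the maximum of \<open>i(H)\<close> over induced subgraphs \<open>H\<close> on \<open>n - d\<close> vertices has to be
  counted (\<open>num_indep_sets_le\<close>). For a graph \<open>H\<close> on \<open>m\<close> vertices with independence number at most \<open>\<alpha>\<close>,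
  a linear form of Zykov's theorem suffices: \<open>i(H) \<le> A\<^sup>\<alpha> x\<^sup>m\<close> whenever \<open>s + 1 \<le> A x\<^sup>s\<close> for all \<open>s\<close>
  (\<open>card_indep_le_power\<close>). Choosing the chord of \<open>ln (s + 1)\<close> between consecutive integers as \<open>ln A + s ln x\<close>
  (\<open>chord_bound\<close>) makes this tight on the exponential scale.

  Lower bound. On about \<open>(1 - c_deg) n\<close> vertices put about \<open>c_ind n\<close> cliques of two consecutive sizes, and
  join them to a circulant graph on the remaining vertices. The circulant brings all degrees up to
  \<open>d\<close>, which is possible because \<open>c_deg \<ge> 1/2\<close>, and has small independence number. A deleted matching and a
  matching of chords make the graph exactly regular (\<open>ex_nda_graph_many_indep_sets\<close>).
\<close>

section \<open>Independent sets in graphs of bounded independence number\<close>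

definition indep :: "'v rel \<Rightarrow> 'v set \<Rightarrow> 'v set set" where
  "indep E W = {S. S \<subseteq> W \<and> (\<forall>u\<in>S. \<forall>v\<in>S. (u, v) \<notin> E)}"

lemma indep_sets_eq_indep: "indep_sets G = indep (parcs G) (pverts G)"
  by (simp add: indep_sets_def indep_def)

lemma finite_indep: "finite W \<Longrightarrow> finite (indep E W)"
  by (rule finite_subset[of _ "Pow W"]) (auto simp: indep_def)

text \<open>
  The hypothesis on \<open>A\<close> and \<open>x\<close> says exactly that the bound holds for
  a single clique on \<open>s\<close> vertices, which has \<open>s + 1\<close> independent sets. It then holds for every graph.
  Let \<open>v\<close> be a vertex of minimum degree, with closed neighbourhood of size \<open>c\<close>. An independent set
  either avoids this closed neighbourhood or contains one of its \<open>c\<close> members \<open>u\<close> and then avoids the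
  rest of the closed neighbourhood of \<open>u\<close>, which has at least \<open>c\<close> vertices. In each of these
  \<open>c + 1\<close> cases at least \<open>c\<close> vertices disappear and the independence number drops by one, so the
  induction multiplies the bound by at most \<open>(c + 1) / (A x\<^sup>c)\<close>, which is at most one.
\<close>

lemma card_indep_le_power:
  fixes A x :: real
  assumes "finite W" and E: "sym E" "irrefl E" and x: "1 \<le> x"
    and clique: "\<And>s::nat. real s + 1 \<le> A * x ^ s"
    and "\<And>S. S \<in> indep E W \<Longrightarrow> card S \<le> \<alpha>"
  shows "real (card (indep E W)) \<le> A ^ \<alpha> * x ^ card W"
  using assms(1,6)
proof (induction W arbitrary: \<alpha> rule: finite_psubset_induct)
  case (psubset W)
  have A: "1 \<le> A" using clique[of 0] by simp
  show ?case
  proof (cases "W = {}")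
    case True
    then have "indep E W = {{}}" by (auto simp: indep_def)
    then show ?thesis using A True by (simp add: one_le_power)
  next
    case False
    define Nb where "Nb u = W \<inter> insert u {w. (u, w) \<in> E}" for u
    have finNb: "finite (Nb u)" for u using psubset.hyps by (simp add: Nb_def)
    obtain v where v: "v \<in> W" and vmin: "\<And>u. u \<in> W \<Longrightarrow> card (Nb v) \<le> card (Nb u)"
      using ex_has_least_nat[of "\<lambda>u. u \<in> W" _ "\<lambda>u. card (Nb u)"] False by blast
    define c where "c = card (Nb v)"
    have cW: "c \<le> card W" unfolding c_def Nb_def by (rule card_mono) (use psubset.hyps in auto)
    have ins: "insert u S \<in> indep E W" "card (insert u S) = Suc (card S)"
      if "u \<in> W" "S \<in> indep E (W - Nb u)" for u S
    proof -
      have "finite S" using that psubset.hyps by (auto simp: indep_def intro: finite_subset)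
      moreover have "u \<notin> S" using that by (auto simp: indep_def Nb_def)
      ultimately show "card (insert u S) = Suc (card S)" by simp
      show "insert u S \<in> indep E W"
        using that E by (auto simp: indep_def Nb_def sym_def irrefl_def)
    qed
    have "{} \<in> indep E (W - Nb v)" by (simp add: indep_def)
    then have \<alpha>: "\<alpha> \<ge> 1" using ins[OF v] psubset.prems by fastforce
    have IH: "real (card (indep E (W - Nb u))) \<le> A ^ (\<alpha> - 1) * x ^ (card W - c)" if u: "u \<in> W" for u
    proof -
      have "real (card (indep E (W - Nb u))) \<le> A ^ (\<alpha> - 1) * x ^ card (W - Nb u)"
      proof (rule psubset.IH)
        show "W - Nb u \<subset> W" using u by (auto simp: Nb_def)
        show "card S \<le> \<alpha> - 1" if "S \<in> indep E (W - Nb u)" for S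
          using psubset.prems[OF ins(1)[OF u that]] ins(2)[OF u that] by simp
      qed
      also have "\<dots> \<le> A ^ (\<alpha> - 1) * x ^ (card W - c)"
      proof (intro mult_left_mono power_increasing)
        have "card (W - Nb u) = card W - card (Nb u)"
          by (rule card_Diff_subset[OF finNb]) (simp add: Nb_def)
        then show "card (W - Nb u) \<le> card W - c" using vmin[OF u] by (simp add: c_def)
      qed (use A x in auto)
      finally show ?thesis .
    qed
    have "indep E W \<subseteq> indep E (W - Nb v) \<union> (\<Union>u\<in>Nb v. insert u ` indep E (W - Nb u))"
    proof
      fix S assume S: "S \<in> indep E W"
      show "S \<in> indep E (W - Nb v) \<union> (\<Union>u\<in>Nb v. insert u ` indep E (W - Nb u))"
      proof (cases "S \<inter> Nb v = {}")
        case True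
        then show ?thesis using S by (auto simp: indep_def)
      next
        case False
        then obtain u where u: "u \<in> S" "u \<in> Nb v" by blast
        then have "S - {u} \<in> indep E (W - Nb u)" "S = insert u (S - {u})"
          using S by (auto simp: indep_def Nb_def)
        then show ?thesis using u by blast
      qed
    qed
    then have "card (indep E W) \<le> card (indep E (W - Nb v) \<union> (\<Union>u\<in>Nb v. insert u ` indep E (W - Nb u)))"
      by (intro card_mono) (auto simp: finNb finite_indep psubset.hyps)
    also have "\<dots> \<le> card (indep E (W - Nb v)) + card (\<Union>u\<in>Nb v. insert u ` indep E (W - Nb u))"
      by (rule card_Un_le)
    also have "card (\<Union>u\<in>Nb v. insert u ` indep E (W - Nb u)) \<le> (\<Sum>u\<in>Nb v. card (insert u ` indep E (W - Nb u)))"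
      by (rule card_UN_le[OF finNb])
    also have "\<dots> \<le> (\<Sum>u\<in>Nb v. card (indep E (W - Nb u)))"
      by (intro sum_mono card_image_le finite_indep) (simp add: psubset.hyps)
    finally have "real (card (indep E W))
        \<le> real (card (indep E (W - Nb v))) + (\<Sum>u\<in>Nb v. real (card (indep E (W - Nb u))))"
      by (simp flip: of_nat_sum of_nat_add)
    also have "\<dots> \<le> A ^ (\<alpha> - 1) * x ^ (card W - c) + (\<Sum>u\<in>Nb v. A ^ (\<alpha> - 1) * x ^ (card W - c))"
      by (intro add_mono sum_mono IH v) (simp add: Nb_def)
    also have "\<dots> = (real c + 1) * (A ^ (\<alpha> - 1) * x ^ (card W - c))"
      by (simp add: c_def algebra_simps)
    also have "\<dots> \<le> (A * x ^ c) * (A ^ (\<alpha> - 1) * x ^ (card W - c))"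
      using A x by (intro mult_right_mono clique) auto
    also have "\<dots> = A ^ Suc (\<alpha> - 1) * x ^ (c + (card W - c))"
      by (simp add: power_add)
    also have "\<dots> = A ^ \<alpha> * x ^ card W" using \<alpha> cW by simp
    finally show ?thesis .
  qed
qed

text \<open>
  In logarithms: the concave sequence \<open>ln (s + 1)\<close> nowhere exceeds its line through \<open>s = t\<close> and
  \<open>s = t + 1\<close>. For \<open>s \<ge> t\<close> this is Bernoulli's inequality for \<open>x = 1 + 1 / (t + 1)\<close>, and for \<open>s < t\<close>
  it follows from that inequality for \<open>1 / x = 1 - 1 / (t + 2)\<close>.
\<close>

lemma chord_bound:
  fixes t s :: nat
  defines "x \<equiv> (real t + 2) / (real t + 1)"
  shows "real s + 1 \<le> ((real t + 1) / x ^ t) * x ^ s"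
proof -
  have x: "x > 0" by (simp add: x_def)
  show ?thesis
  proof (cases "t \<le> s")
    case True
    have "1 + real (s - t) * (1 / (real t + 1)) \<le> (1 + 1 / (real t + 1)) ^ (s - t)"
      by (intro Bernoulli_inequality) (simp add: field_simps)
    moreover have "x = 1 + 1 / (real t + 1)" by (simp add: x_def field_simps)
    ultimately have "1 + real (s - t) / (real t + 1) \<le> x ^ (s - t)" by simp
    then have "(real t + 1) * (1 + real (s - t) / (real t + 1)) \<le> (real t + 1) * x ^ (s - t)"
      by (intro mult_left_mono) auto
    then have "real s + 1 \<le> (real t + 1) * x ^ (s - t)"
      using True by (simp add: of_nat_diff distrib_left)
    then show ?thesis using x True by (simp add: power_diff)
  next
    case False
    have "1 + real (t - s) * (- 1 / (real t + 2)) \<le> (1 + - 1 / (real t + 2)) ^ (t - s)"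
      by (intro Bernoulli_inequality) (simp add: field_simps)
    moreover have "1 / x = 1 - 1 / (real t + 2)" by (simp add: x_def field_simps)
    ultimately have "1 - real (t - s) / (real t + 2) \<le> (1 / x) ^ (t - s)" by simp
    moreover have "(real s + 1) / (real t + 1) \<le> 1 - real (t - s) / (real t + 2)"
      using False by (simp add: of_nat_diff field_simps)
    ultimately have "(real s + 1) / (real t + 1) \<le> (1 / x) ^ (t - s)" by linarith
    then have "real s + 1 \<le> (real t + 1) * (1 / x) ^ (t - s)" by (simp add: field_simps)
    also have "(1 / x) ^ (t - s) = x ^ s / x ^ t"
      using x False by (simp add: power_one_over power_diff)
    finally show ?thesis by simp
  qed
qed

section \<open>Reduction from regular graphs to non-neighbourhoods\<close>

lemma out_degree_with_proj: "out_degree (with_proj G) v = card {w. (v, w) \<in> parcs G}"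
proof -
  have "out_arcs (with_proj G) v = Pair v ` {w. (v, w) \<in> parcs G}"
    by (auto simp: out_arcs_def)
  then show ?thesis by (simp add: out_degree_def card_image inj_on_def)
qed

text \<open>
  A non-empty independent set containing \<open>v\<close> lives inside the \<open>n - d\<close> non-neighbours of \<open>v\<close>. Summing
  over the \<open>n\<close> choices of \<open>v\<close> costs only a polynomial factor, and the bound for general graphs applies
  to each of the small induced subgraphs.
\<close>

lemma num_indep_sets_le:
  fixes A x :: real
  assumes G: "nda_graph n d \<alpha> G" and x: "1 \<le> x"
    and clique: "\<And>s::nat. real s + 1 \<le> A * x ^ s"
  shows "real (num_indep_sets G) \<le> (real n + 1) * (A ^ \<alpha> * x ^ (n - d))"
proof -
  define V where "V = pverts G"
  define E where "E = parcs G"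
  from G have pg: "pair_graph G" and n: "card V = n"
    and deg: "\<And>v. v \<in> V \<Longrightarrow> card {w. (v, w) \<in> E} = d"
    and ind: "independence_number G \<le> \<alpha>"
    by (auto simp: nda_graph_def V_def E_def out_degree_with_proj)
  interpret pair_graph G by fact
  have fin: "finite V" by (simp add: V_def pair_finite_verts)
  have "sym E" using pair_sym_arcs by (simp add: E_def symmetric_def)
  have "irrefl E" using no_loops' by (auto simp: E_def irrefl_def)
  have nbV: "{w. (v, w) \<in> E} \<subseteq> V" for v using in_arcsD2 by (auto simp: E_def V_def)
  have A: "1 \<le> A" using clique[of 0] by simp
  have small: "card S \<le> \<alpha>" if "S \<in> indep E V" for S
  proof -
    have "card S \<le> independence_number G" unfolding independence_number_def
      using that fin by (intro Max_ge) (auto simp: indep_sets_eq_indep finite_indep E_def V_def)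
    then show ?thesis using ind by simp
  qed
  have bound: "real (card (indep E (V - {w. (v, w) \<in> E}))) \<le> A ^ \<alpha> * x ^ (n - d)" if "v \<in> V" for v
  proof -
    have "real (card (indep E (V - {w. (v, w) \<in> E}))) \<le> A ^ \<alpha> * x ^ card (V - {w. (v, w) \<in> E})"
      using fin \<open>sym E\<close> \<open>irrefl E\<close> x clique
      by (intro card_indep_le_power small) (auto simp: indep_def)
    also have "card (V - {w. (v, w) \<in> E}) = n - d"
      using card_Diff_subset[OF finite_subset[OF nbV fin] nbV] n deg[OF that] by simp
    finally show ?thesis .
  qed
  have "indep E V \<subseteq> insert {} (\<Union>v\<in>V. indep E (V - {w. (v, w) \<in> E}))"
    by (auto simp: indep_def)
  then have "card (indep E V) \<le> card (insert {} (\<Union>v\<in>V. indep E (V - {w. (v, w) \<in> E})))"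
    by (intro card_mono) (auto simp: fin finite_indep)
  also have "\<dots> \<le> Suc (card (\<Union>v\<in>V. indep E (V - {w. (v, w) \<in> E})))"
    by (rule card_insert_le_m1) auto
  also have "card (\<Union>v\<in>V. indep E (V - {w. (v, w) \<in> E})) \<le> (\<Sum>v\<in>V. card (indep E (V - {w. (v, w) \<in> E})))"
    by (rule card_UN_le[OF fin])
  finally have "real (card (indep E V)) \<le> 1 + (\<Sum>v\<in>V. real (card (indep E (V - {w. (v, w) \<in> E}))))"
    by (simp flip: of_nat_sum of_nat_Suc)
  also have "\<dots> \<le> A ^ \<alpha> * x ^ (n - d) + (\<Sum>v\<in>V. A ^ \<alpha> * x ^ (n - d))"
  proof (intro add_mono sum_mono bound)
    have "1 * 1 \<le> A ^ \<alpha> * x ^ (n - d)" using A x by (intro mult_mono one_le_power) auto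
    then show "1 \<le> A ^ \<alpha> * x ^ (n - d)" by simp
  qed
  also have "\<dots> = (real n + 1) * (A ^ \<alpha> * x ^ (n - d))" by (simp add: n algebra_simps)
  finally show ?thesis by (simp add: num_indep_sets_def indep_sets_eq_indep E_def V_def)
qed

section \<open>Disjoint unions of cliques\<close>

text \<open>
  Vertex \<open>(j, i)\<close> is the \<open>i\<close>-th vertex of the \<open>j\<close>-th clique, so the vertex set is always
  \<open>SIGMA j:{..<K}. {..<sz j}\<close>.
\<close>

definition cliques :: "nat \<Rightarrow> (nat \<Rightarrow> nat) \<Rightarrow> (nat \<times> nat) rel" where
  "cliques K sz = {((j, i), (j', i')). j < K \<and> j' = j \<and> i < sz j \<and> i' < sz j \<and> i \<noteq> i'}"

lemma card_cliques_neighbours: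
  assumes "j < K" "i < sz j"
  shows "card {y. ((j, i), y) \<in> cliques K sz} = sz j - 1"
proof -
  have "{y. ((j, i), y) \<in> cliques K sz} = Pair j ` ({..<sz j} - {i})"
    using assms by (auto simp: cliques_def)
  then show ?thesis using assms by (simp add: card_image inj_on_def)
qed

lemma card_indep_set_cliques_le:
  assumes S: "S \<in> indep (cliques K sz) (SIGMA j:{..<K}. {..<sz j})"
  shows "card S \<le> K"
proof -
  have "inj_on fst S"
  proof (rule inj_onI, clarsimp)
    fix j i i' assume "(j, i) \<in> S" "(j, i') \<in> S"
    then show "i = i'" using S by (force simp: indep_def cliques_def)
  qed
  then have "card S = card (fst ` S)" by (rule card_image[symmetric])
  also have "\<dots> \<le> card {..<K}" using S by (intro card_mono) (auto simp: indep_def)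
  finally show ?thesis by simp
qed

lemma card_indep_cliques_ge:
  "(\<Prod>j<K. sz j + 1) \<le> card (indep (cliques K sz) (SIGMA j:{..<K}. {..<sz j}))"
proof -
  \<comment> \<open>A function in \<open>F\<close> names the vertex chosen in each clique; the extra value \<open>sz j\<close> stands
      for choosing none.\<close>
  define F where "F = (PiE {..<K} (\<lambda>j. {..sz j}))"
  define set_of where "set_of f = {(j, i). j < K \<and> i = f j \<and> i < sz j}" for f :: "nat \<Rightarrow> nat"
  have "(\<Prod>j<K. sz j + 1) = card F" by (simp add: F_def card_PiE)
  also have "\<dots> = card (set_of ` F)"
  proof (rule card_image[symmetric], rule inj_onI)
    fix f g assume f: "f \<in> F" and g: "g \<in> F" and eq: "set_of f = set_of g"
    show "f = g"
    proof (rule PiE_ext[OF f[unfolded F_def] g[unfolded F_def]])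
      fix j assume j: "j \<in> {..<K}"
      have "f j \<le> sz j" "g j \<le> sz j" using f g j by (auto simp: F_def)
      moreover have "f j < sz j \<and> i = f j \<longleftrightarrow> g j < sz j \<and> i = g j" for i
        using arg_cong[OF eq, of "\<lambda>S. (j, i) \<in> S"] j by (auto simp: set_of_def)
      from this[of "f j"] this[of "g j"] have "f j < sz j \<or> g j < sz j \<Longrightarrow> f j = g j" by blast
      ultimately show "f j = g j" by linarith
    qed
  qed
  also have "\<dots> \<le> card (indep (cliques K sz) (SIGMA j:{..<K}. {..<sz j}))"
  proof (intro card_mono finite_indep)
    show "set_of ` F \<subseteq> indep (cliques K sz) (SIGMA j:{..<K}. {..<sz j})"
      by (auto simp: set_of_def indep_def cliques_def)
  qed simp
  finally show ?thesis .
qed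

section \<open>Circulant graphs with chords\<close>

text \<open>
  The Cayley graph on the integers modulo \<open>b\<close> with connection set the non-zero residues
  \<open>-s, ..., s\<close>, that is, the \<open>s\<close>-th power of a cycle. It realises any even degree below \<open>b\<close>, and its
  independence number is at most \<open>b / (s + 1)\<close>.
\<close>

definition circulant :: "nat \<Rightarrow> nat \<Rightarrow> int rel" where
  "circulant b s = {(x, y). x \<in> {0..<int b} \<and> y \<in> {0..<int b} \<and>
     (y - x) mod int b \<in> {1..int s} \<union> {int b - int s..<int b}}"

lemma sym_circulant: "s < b \<Longrightarrow> sym (circulant b s)"
proof (rule symI)
  fix x y assume "s < b" and xy: "(x, y) \<in> circulant b s"
  define m where "m = (y - x) mod int b"
  have m: "0 \<le> m" "m < int b" using \<open>s < b\<close> by (auto simp: m_def)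
  have "(x - y) mod int b = (- (y - x)) mod int b" by simp
  also have "\<dots> = (if m = 0 then 0 else int b - m)"
    unfolding m_def by (rule zmod_zminus1_eq_if)
  finally show "(y, x) \<in> circulant b s"
    using xy m \<open>s < b\<close> by (auto simp: circulant_def simp flip: m_def)
qed

lemma irrefl_circulant: "s < b \<Longrightarrow> irrefl (circulant b s)"
  by (auto simp: irrefl_def circulant_def)

lemma card_circulant_neighbours:
  assumes "2 * s < b" and x: "x \<in> {0..<int b}"
  shows "card {y. (x, y) \<in> circulant b s} = 2 * s"
proof -
  let ?J = "{1..int s} \<union> {int b - int s..<int b}"
  have "bij_betw (\<lambda>j. (x + j) mod int b) ?J {y. (x, y) \<in> circulant b s}"
  proof (rule bij_betw_byWitness[where f' = "\<lambda>y. (y - x) mod int b"])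
    show "\<forall>a\<in>?J. ((x + a) mod int b - x) mod int b = a"
      using assms by (auto simp: mod_diff_left_eq)
    show "\<forall>a'\<in>{y. (x, y) \<in> circulant b s}. (x + (a' - x) mod int b) mod int b = a'"
      by (auto simp: circulant_def mod_add_right_eq)
    show "(\<lambda>j. (x + j) mod int b) ` ?J \<subseteq> {y. (x, y) \<in> circulant b s}"
      using assms by (auto simp: circulant_def mod_diff_left_eq)
    show "(\<lambda>y. (y - x) mod int b) ` {y. (x, y) \<in> circulant b s} \<subseteq> ?J"
      by (auto simp: circulant_def)
  qed
  then have "card {y. (x, y) \<in> circulant b s} = card ?J" by (simp add: bij_betw_same_card)
  also have "\<dots> = 2 * s" using assms by (subst card_Un_disjoint) auto
  finally show ?thesis .
qed

text \<open>
  The arcs \<open>x, x + 1, ..., x + s\<close> starting at the members \<open>x\<close> of an independent set are disjoint.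
\<close>

lemma card_indep_circulant_le:
  assumes "s < b" and I: "I \<in> indep (circulant b s) {0..<int b}"
  shows "card I * (s + 1) \<le> b"
proof -
  have I': "I \<subseteq> {0..<int b}" and nonadj: "\<And>u v. u \<in> I \<Longrightarrow> v \<in> I \<Longrightarrow> (u, v) \<notin> circulant b s"
    using I by (auto simp: indep_def)
  have key: "x = y \<and> j = j'"
    if "x \<in> I" "y \<in> I" "0 \<le> j" "j \<le> j'" "j' \<le> int s" "(x + j) mod int b = (y + j') mod int b" for x y j j'
  proof -
    have xy: "x \<in> {0..<int b}" "y \<in> {0..<int b}" using that I' by auto
    have "(x - y) mod int b = ((x + j) - (y + j)) mod int b" by simp
    also have "\<dots> = ((y + j') - (y + j)) mod int b" using that(6) by (rule mod_diff_cong) simp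
    also have "\<dots> = j' - j" using that \<open>s < b\<close> by simp
    finally have e: "(x - y) mod int b = j' - j" .
    have "j' = j"
    proof (rule ccontr)
      assume "j' \<noteq> j"
      then have "(y, x) \<in> circulant b s" using e xy that by (auto simp: circulant_def)
      then show False using nonadj that by blast
    qed
    with e have "x mod int b = y mod int b" by (simp add: mod_eq_dvd_iff dvd_eq_mod_eq_0)
    then show ?thesis using xy \<open>j' = j\<close> by simp
  qed
  have inj: "inj_on (\<lambda>(x, j). (x + j) mod int b) (I \<times> {0..int s})"
  proof (rule inj_onI, clarify)
    fix x j y j' assume a: "x \<in> I" "j \<in> {0..int s}" "y \<in> I" "j' \<in> {0..int s}"
      "(x + j) mod int b = (y + j') mod int b"
    show "x = y \<and> j = j'"
    proof (cases "j \<le> j'")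
      case True then show ?thesis using key[of x y j j'] a by auto
    next
      case False then show ?thesis using key[of y x j' j] a by auto
    qed
  qed
  have "card I * (s + 1) = card (I \<times> {0..int s})" by (simp add: card_cartesian_product nat_add_distrib)
  also have "\<dots> = card ((\<lambda>(x, j). (x + j) mod int b) ` (I \<times> {0..int s}))"
    by (rule card_image[OF inj, symmetric])
  also have "\<dots> \<le> card {0..<int b}" using \<open>s < b\<close> by (intro card_mono) auto
  finally show ?thesis by simp
qed

text \<open>
  A matching of long chords on the \<open>2 w\<close> vertices \<open>i\<close> and \<open>i + h\<close> with \<open>i < w\<close>. Added to a circulant,
  it raises the degree of exactly these vertices by one.
\<close>

definition chords :: "nat \<Rightarrow> nat \<Rightarrow> int rel" where
  "chords h w = {(x, y). (0 \<le> x \<and> x < int w \<and> y = x + int h) \<or> (0 \<le> y \<and> y < int w \<and> x = y + int h)}"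

text \<open>
  The two ends of a chord are at cyclic distance \<open>min h (b - h) = h > s\<close>, so no chord is already an
  edge of the circulant.
\<close>

lemma card_circulant_chords_neighbours:
  assumes "s < h" "2 * h \<le> b" "w \<le> h" and x: "x \<in> {0..<int b}"
  shows "card {y. (x, y) \<in> circulant b s \<union> chords h w}
    = (if x \<in> {0..<int w} \<union> {int h..<int h + int w} then 2 * s + 1 else 2 * s)"
proof -
  have ch: "{y. (x, y) \<in> chords h w} =
      (if x \<in> {0..<int w} then {x + int h} else if x \<in> {int h..<int h + int w} then {x - int h} else {})"
    using assms by (auto simp: chords_def)
  have disj: "{y. (x, y) \<in> circulant b s} \<inter> {y. (x, y) \<in> chords h w} = {}"
  proof -
    have "(int h) mod int b = int h" using assms by simp
    moreover have "(- int h) mod int b = int b - int h"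
      using assms by (simp add: zmod_zminus1_eq_if)
    ultimately show ?thesis using assms by (auto simp: circulant_def chords_def)
  qed
  have "finite {y. (x, y) \<in> circulant b s}"
    by (rule finite_subset[of _ "{0..<int b}"]) (auto simp: circulant_def)
  then have "card {y. (x, y) \<in> circulant b s \<union> chords h w}
      = card {y. (x, y) \<in> circulant b s} + card {y. (x, y) \<in> chords h w}"
    using disj by (subst card_Un_disjoint[symmetric]) (auto simp: ch Collect_disj_eq)
  then show ?thesis using assms by (simp add: card_circulant_neighbours ch)
qed

section \<open>Joins with a deleted matching\<close>

text \<open>
  The join of the graphs \<open>(X, R)\<close> and \<open>(Y, Q)\<close>, minus the matching of each \<open>x\<close> in \<open>X1\<close> with \<open>g x\<close>. The
  deleted matching compensates for degrees that are one too large on \<open>X1\<close> and on its image.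
\<close>

definition near_join ::
  "'a set \<Rightarrow> 'a rel \<Rightarrow> 'b set \<Rightarrow> 'b rel \<Rightarrow> 'a set \<Rightarrow> ('a \<Rightarrow> 'b) \<Rightarrow> ('a + 'b) rel" where
  "near_join X R Y Q X1 g =
     {(u, v). case (u, v) of
         (Inl x, Inl x') \<Rightarrow> (x, x') \<in> R
       | (Inr y, Inr y') \<Rightarrow> (y, y') \<in> Q
       | (Inl x, Inr y) \<Rightarrow> x \<in> X \<and> y \<in> Y \<and> \<not> (x \<in> X1 \<and> g x = y)
       | (Inr y, Inl x) \<Rightarrow> x \<in> X \<and> y \<in> Y \<and> \<not> (x \<in> X1 \<and> g x = y)}"

lemma near_join_simps [simp]:
  "(Inl x, Inl x') \<in> near_join X R Y Q X1 g \<longleftrightarrow> (x, x') \<in> R"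
  "(Inr y, Inr y') \<in> near_join X R Y Q X1 g \<longleftrightarrow> (y, y') \<in> Q"
  "(Inl x, Inr y) \<in> near_join X R Y Q X1 g \<longleftrightarrow> x \<in> X \<and> y \<in> Y \<and> \<not> (x \<in> X1 \<and> g x = y)"
  "(Inr y, Inl x) \<in> near_join X R Y Q X1 g \<longleftrightarrow> x \<in> X \<and> y \<in> Y \<and> \<not> (x \<in> X1 \<and> g x = y)"
  by (simp_all add: near_join_def)

lemma card_sum_Collect:
  assumes "finite {x. P (Inl x)}" "finite {y. P (Inr y)}"
  shows "card {z. P z} = card {x. P (Inl x)} + card {y. P (Inr y)}"
proof -
  have "{z. P z} = {x. P (Inl x)} <+> {y. P (Inr y)}"
    by (auto simp: Plus_def image_iff) (metis sum.exhaust)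
  then show ?thesis using assms by (simp add: card_Plus)
qed

lemma card_near_join_neighbours:
  assumes fin: "finite X" "finite Y" and R: "R \<subseteq> X \<times> X" and Q: "Q \<subseteq> Y \<times> Y"
    and g: "bij_betw g X1 Y1" "X1 \<subseteq> X" "Y1 \<subseteq> Y"
  shows "x \<in> X \<Longrightarrow> card {z. (Inl x, z) \<in> near_join X R Y Q X1 g}
           = card {x'. (x, x') \<in> R} + (card Y - (if x \<in> X1 then 1 else 0))"
    and "y \<in> Y \<Longrightarrow> card {z. (Inr y, z) \<in> near_join X R Y Q X1 g}
           = card {y'. (y, y') \<in> Q} + (card X - (if y \<in> Y1 then 1 else 0))"
proof -
  assume x: "x \<in> X"
  have "{y. y \<in> Y \<and> \<not> (x \<in> X1 \<and> g x = y)} = Y - (if x \<in> X1 then {g x} else {})" by auto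
  moreover have "x \<in> X1 \<Longrightarrow> g x \<in> Y" using g by (auto simp: bij_betw_def)
  ultimately have "card {y. y \<in> Y \<and> \<not> (x \<in> X1 \<and> g x = y)} = card Y - (if x \<in> X1 then 1 else 0)"
    using fin by simp
  moreover have "finite {x'. (x, x') \<in> R}" by (rule finite_subset[OF _ fin(1)]) (use R in auto)
  ultimately show "card {z. (Inl x, z) \<in> near_join X R Y Q X1 g}
           = card {x'. (x, x') \<in> R} + (card Y - (if x \<in> X1 then 1 else 0))"
    using x fin card_sum_Collect[of "\<lambda>z. (Inl x, z) \<in> near_join X R Y Q X1 g"] by simp
next
  assume y: "y \<in> Y"
  have "card {x. x \<in> X \<and> \<not> (x \<in> X1 \<and> g x = y)} = card X - (if y \<in> Y1 then 1 else 0)"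
  proof (cases "y \<in> Y1")
    case True
    then obtain x where "x \<in> X1" "g x = y" using g by (auto simp: bij_betw_def)
    then have "{x. x \<in> X \<and> \<not> (x \<in> X1 \<and> g x = y)} = X - {x}"
      using inj_on_eq_iff[OF bij_betw_imp_inj_on[OF g(1)], of _ x] by auto
    then show ?thesis using True \<open>x \<in> X1\<close> g fin by auto
  next
    case False
    then have "{x. x \<in> X \<and> \<not> (x \<in> X1 \<and> g x = y)} = X" using g by (auto simp: bij_betw_def)
    then show ?thesis using False by simp
  qed
  moreover have "finite {y'. (y, y') \<in> Q}" by (rule finite_subset[OF _ fin(2)]) (use Q in auto)
  ultimately show "card {z. (Inr y, z) \<in> near_join X R Y Q X1 g}
           = card {y'. (y, y') \<in> Q} + (card X - (if y \<in> Y1 then 1 else 0))"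
    using y fin card_sum_Collect[of "\<lambda>z. (Inr y, z) \<in> near_join X R Y Q X1 g"] by simp
qed

text \<open>
  An independent set that meets \<open>X\<close> in some \<open>x\<close> can contain at most one vertex of \<open>Y\<close>, namely \<open>g x\<close>.
\<close>

lemma card_indep_set_near_join_le:
  assumes fin: "finite X" "finite Y"
    and X: "\<And>S. S \<in> indep R X \<Longrightarrow> card S \<le> m"
    and Y: "\<And>S. S \<in> indep Q Y \<Longrightarrow> card S \<le> m + 1"
    and S: "S \<in> indep (near_join X R Y Q X1 g) (X <+> Y)"
  shows "card S \<le> m + 1"
proof -
  define SX where "SX = Inl -` S"
  define SY where "SY = Inr -` S"
  have S_eq: "S = SX <+> SY"
    by (auto simp: SX_def SY_def Plus_def image_iff) (metis sum.exhaust)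
  have SX: "SX \<in> indep R X" and SY: "SY \<in> indep Q Y"
    using S by (force simp: indep_def SX_def SY_def)+
  then have "SX \<subseteq> X" "SY \<subseteq> Y" by (auto simp: indep_def)
  then have fS: "finite SX" "finite SY" using fin by (auto intro: finite_subset)
  have card_S: "card S = card SX + card SY" by (simp add: S_eq card_Plus fS)
  show ?thesis
  proof (cases "SX = {}")
    case True
    then show ?thesis using card_S Y[OF SY] by simp
  next
    case False
    then obtain x where x: "x \<in> SX" by blast
    have "SY \<subseteq> {g x}"
    proof
      fix y assume "y \<in> SY"
      then have "(Inl x, Inr y) \<notin> near_join X R Y Q X1 g"
        using x S unfolding indep_def SX_def SY_def by blast
      then show "y \<in> {g x}" using x \<open>y \<in> SY\<close> \<open>SX \<subseteq> X\<close> \<open>SY \<subseteq> Y\<close> by auto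
    qed
    then have "card SY \<le> card {g x}" by (intro card_mono) auto
    then show ?thesis using card_S X[OF SX] by simp
  qed
qed

lemma card_indep_near_join_ge:
  assumes "finite X" "finite Y"
  shows "card (indep R X) \<le> card (indep (near_join X R Y Q X1 g) (X <+> Y))"
proof (rule card_inj_on_le[where f = "(`) Inl"])
  show "inj_on ((`) Inl) (indep R X)" by (simp add: inj_on_def inj_image_eq_iff)
  show "(`) Inl ` indep R X \<subseteq> indep (near_join X R Y Q X1 g) (X <+> Y)"
    by (auto simp: indep_def)
  show "finite (indep (near_join X R Y Q X1 g) (X <+> Y))"
    using assms by (intro finite_indep) simp
qed

section \<open>Construction of the extremal graph\<close>

text \<open>
  The construction is carried out on a convenient countable vertex type; this transports it to the
  natural numbers.
\<close>

lemma nda_graph_nat_copy: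
  fixes V :: "'v::countable set"
  assumes fin: "finite V" and E: "E \<subseteq> V \<times> V" "sym E" "irrefl E"
    and deg: "\<And>v. v \<in> V \<Longrightarrow> card {w. (v, w) \<in> E} = d"
    and small: "\<And>S. S \<in> indep E V \<Longrightarrow> card S \<le> \<alpha>"
  obtains G :: "nat pair_pre_digraph"
  where "nda_graph (card V) d \<alpha> G" and "num_indep_sets G = card (indep E V)"
proof -
  define f where "f = (to_nat :: 'v \<Rightarrow> nat)"
  have inj: "inj f" by (simp add: f_def)
  have f_eq [simp]: "f x = f y \<longleftrightarrow> x = y" for x y using inj by (simp add: inj_eq)
  define G where "G = \<lparr>pverts = f ` V, parcs = map_prod f f ` E\<rparr>"
  have finE: "finite E" by (rule finite_subset[OF E(1)]) (simp add: fin)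
  have pg: "pair_graph G"
  proof
    show "symmetric G" using E(2) by (auto simp: G_def symmetric_def sym_def)
    show "finite (pverts G)" "finite (parcs G)" by (simp_all add: G_def fin finE)
  qed (use E in \<open>auto simp: G_def irrefl_def\<close>)
  have ind: "indep_sets G = (`) f ` indep E V"
  proof
    show "indep_sets G \<subseteq> (`) f ` indep E V"
    proof
      fix S assume S: "S \<in> indep_sets G"
      then obtain T where T: "T \<subseteq> V" "S = f ` T"
        by (auto simp: indep_sets_def G_def subset_image_iff)
      then have "T \<in> indep E V" using S by (force simp: indep_sets_def G_def indep_def)
      then show "S \<in> (`) f ` indep E V" using T by blast
    qed
    show "(`) f ` indep E V \<subseteq> indep_sets G"
      by (auto simp: indep_sets_def G_def indep_def)
  qed
  have deg': "out_degree (with_proj G) v = d" if v: "v \<in> pverts G" for v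
  proof -
    obtain u where u: "u \<in> V" "v = f u" using v by (auto simp: G_def)
    have "{w. (v, w) \<in> parcs G} = f ` {w. (u, w) \<in> E}" by (auto simp: G_def u)
    then show ?thesis
      using deg[OF u(1)] by (simp add: out_degree_with_proj card_image inj_on_def)
  qed
  have card_f: "card (f ` S) = card S" for S by (simp add: card_image inj_on_def)
  have "independence_number G \<le> \<alpha>"
    unfolding independence_number_def ind
  proof (rule Max.boundedI)
    show "finite (card ` (`) f ` indep E V)" using fin by (simp add: finite_indep)
    have "{} \<in> indep E V" by (simp add: indep_def)
    then show "card ` (`) f ` indep E V \<noteq> {}" by blast
    show "k \<le> \<alpha>" if "k \<in> card ` (`) f ` indep E V" for k
      using that small by (auto simp: card_f)
  qed
  moreover have "card (pverts G) = card V" by (simp add: G_def card_f)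
  ultimately have "nda_graph (card V) d \<alpha> G" using pg deg' by (simp add: nda_graph_def)
  moreover have "num_indep_sets G = card (indep E V)"
    unfolding num_indep_sets_def ind by (rule card_image) (simp add: inj_on_def inj_image_eq_iff inj)
  ultimately show ?thesis by (rule that)
qed

text \<open>
  The extremal graph. One side \<open>X\<close> consists of \<open>2 P\<close> cliques of size \<open>t\<close> and \<open>2 U\<close> cliques of size
  \<open>t + 1\<close>, which alone provide the required independent sets. The other side \<open>Y\<close> is the set of residues
  modulo \<open>b = n - 2 a\<close>, carrying a circulant. The two sides are joined completely, after which
  the vertices of the larger cliques have one neighbour too many. Deleting a matching between the set
  \<open>X1\<close> of these vertices and equally many vertices \<open>Y1\<close> of \<open>Y\<close> repairs this, and each vertex of \<open>Y1\<close>
  receives a chord in return.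

  The parameter \<open>s\<close> is forced by regularity, since the degree \<open>b + t - 1\<close> on \<open>X\<close> has to equal
  \<open>2 a + 2 s\<close> on \<open>Y\<close>; this is where the parity condition comes from. The size condition is equivalent
  to \<open>s \<ge> 2 t\<close>, which makes the circulant dense enough for its independence number not to exceed
  the number of cliques by more than one. Both clique sizes occur an even number of times: then \<open>X1\<close>
  has even size and can be matched with the ends of chords, and the parity condition depends on \<open>n\<close>
  and \<open>t\<close> only.
\<close>

lemma ex_nda_graph_many_indep_sets:
  fixes n t P U :: nat
  defines "a \<equiv> P * t + U * (t + 1)"
  assumes t: "1 \<le> t" and P: "1 \<le> P" and par: "even (n + t + 1)" and n: "4 * a + 3 * t + 1 \<le> n"
  shows "\<exists>G :: nat pair_pre_digraph. nda_graph n (n + t - 1 - 2 * a) (2 * P + 2 * U + 1) G \<and>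
           (t + 1) ^ (2 * P) * (t + 2) ^ (2 * U) \<le> num_indep_sets G"
proof -
  define K where "K = 2 * U + 2 * P"
  define sz where "sz j = (if j < 2 * U then t + 1 else t)" for j
  define X where "X = (SIGMA j:{..<K}. {..<sz j})"
  define R where "R = cliques K sz"
  define X1 where "X1 = {..<2 * U} \<times> {..<t + 1}"
  define w where "w = U * (t + 1)"
  define b where "b = n - 2 * a"
  obtain s where s: "n + t - 1 - 4 * a = 2 * s"
  proof -
    have "even (n + t - 1 - 4 * a)" using par n t by auto
    then show ?thesis by (elim evenE) (rule that)
  qed
  have "t \<le> a" using P by (simp add: a_def trans_le_add1)
  \<comment> \<open>The chord length is chosen so that \<open>b = 2 h + t - 1\<close>: as \<open>t \<ge> 1\<close>, a chord stays
      at cyclic distance \<open>h\<close> whatever the parity of \<open>b\<close>.\<close>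
  define h where "h = s + a + 1 - t"
  have s_ge: "2 * t \<le> s" using s n t by linarith
  have b_eq: "b + 1 = 2 * h + t" using s n t \<open>t \<le> a\<close> by (simp add: b_def h_def)
  have "s < h" "2 * h \<le> b" "2 * s < b" "s < b"
    using b_eq t \<open>t \<le> a\<close> by (auto simp: h_def)
  have "w \<le> h" using s_ge t by (simp add: h_def a_def w_def)
  define Y where "Y = {0..<int b}"
  define Q where "Q = circulant b s \<union> chords h w"
  define Y1 where "Y1 = {0..<int w} \<union> {int h..<int h + int w}"
  have fin: "finite X" "finite Y" by (simp_all add: X_def Y_def)
  have large_small: "{..<K} \<inter> {j. j < 2 * U} = {..<2 * U}" "{..<K} \<inter> - {j. j < 2 * U} = {2 * U..<K}"
      "K - 2 * U = 2 * P"
    by (auto simp: K_def)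
  have cX: "card X = 2 * a"
  proof -
    have "card X = (\<Sum>j<K. sz j)" by (simp add: X_def)
    also have "\<dots> = 2 * U * (t + 1) + 2 * P * t" by (simp add: sz_def sum.If_cases large_small)
    also have "\<dots> = 2 * a" by (simp add: a_def)
    finally show ?thesis .
  qed
  have cY: "card Y = b" by (simp add: Y_def)
  have sub1: "X1 \<subseteq> X" by (auto simp: X1_def X_def sz_def K_def)
  have sub2: "Y1 \<subseteq> Y" using \<open>w \<le> h\<close> \<open>2 * h \<le> b\<close> by (auto simp: Y1_def Y_def)
  have "card Y1 = 2 * w"
    using \<open>w \<le> h\<close> by (simp add: Y1_def card_Un_disjoint)
  moreover have "card X1 = 2 * w" by (simp add: X1_def w_def)
  ultimately obtain g where g: "bij_betw g X1 Y1"
    using finite_same_card_bij[of X1 Y1] fin sub1 sub2 by (auto intro: finite_subset)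
  have R: "R \<subseteq> X \<times> X" "sym R" "irrefl R"
    by (auto simp: R_def X_def cliques_def sym_def irrefl_def)
  have Q: "Q \<subseteq> Y \<times> Y" "sym Q" "irrefl Q"
  proof -
    show "Q \<subseteq> Y \<times> Y"
      using \<open>w \<le> h\<close> \<open>2 * h \<le> b\<close> by (auto simp: Q_def Y_def circulant_def chords_def)
    have "sym (chords h w)" by (auto simp: sym_def chords_def)
    then show "sym Q" unfolding Q_def by (intro sym_Un sym_circulant \<open>s < b\<close>)
    have "irrefl (chords h w)" using \<open>s < h\<close> by (auto simp: irrefl_def chords_def)
    then show "irrefl Q" using irrefl_circulant[OF \<open>s < b\<close>] by (auto simp: Q_def irrefl_def)
  qed
  define E where "E = near_join X R Y Q X1 g"
  define V where "V = X <+> Y"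
  have finV: "finite V" by (simp add: V_def fin)
  have cV: "card V = n" using n by (simp add: V_def card_Plus fin cX cY b_def)
  have E: "E \<subseteq> V \<times> V" "sym E" "irrefl E"
  proof -
    show "E \<subseteq> V \<times> V"
    proof
      fix z assume "z \<in> E"
      then show "z \<in> V \<times> V"
        using R(1) Q(1) unfolding E_def V_def
        by (cases z; cases "fst z"; cases "snd z") auto
    qed
    show "sym E"
    proof (rule symI)
      fix u v assume "(u, v) \<in> E"
      then show "(v, u) \<in> E"
        using R(2) Q(2) unfolding E_def by (cases u; cases v) (auto dest: symD)
    qed
    show "irrefl E"
    proof (rule irreflI)
      fix u show "(u, u) \<notin> E"
        using R(3) Q(3) unfolding E_def by (cases u) (auto simp: irrefl_def)
    qed
  qed
  have deg: "card {v. (u, v) \<in> E} = n + t - 1 - 2 * a" if "u \<in> V" for u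
  proof (cases u)
    case (Inl x)
    then have x: "x \<in> X" using that by (auto simp: V_def)
    then obtain j i where x_eq: "x = (j, i)" "j < K" "i < sz j" by (auto simp: X_def)
    have "card {v. (u, v) \<in> E} = sz j - 1 + (b - (if x \<in> X1 then 1 else 0))"
      using card_near_join_neighbours(1)[OF fin R(1) Q(1) g sub1 sub2 x]
        card_cliques_neighbours[of j K i sz] x_eq(2,3) by (simp add: Inl E_def R_def x_eq(1) cY)
    also have "x \<in> X1 \<longleftrightarrow> j < 2 * U" using x_eq by (auto simp: X1_def sz_def)
    finally show ?thesis using t n by (auto simp: sz_def b_def)
  next
    case (Inr y)
    then have y: "y \<in> Y" using that by (auto simp: V_def)
    have "card {v. (u, v) \<in> E} = (if y \<in> Y1 then 2 * s + 1 else 2 * s) + (2 * a - (if y \<in> Y1 then 1 else 0))"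
      using card_near_join_neighbours(2)[OF fin R(1) Q(1) g sub1 sub2 y]
        card_circulant_chords_neighbours[OF \<open>s < h\<close> \<open>2 * h \<le> b\<close> \<open>w \<le> h\<close> y[unfolded Y_def]]
      by (simp add: Inr E_def Q_def cX Y1_def)
    then show ?thesis using s n t \<open>t \<le> a\<close> by (auto split: if_splits)
  qed
  have small: "card S \<le> K + 1" if "S \<in> indep E V" for S
  proof (rule card_indep_set_near_join_le[OF fin _ _ that[unfolded E_def V_def]])
    show "card S \<le> K" if "S \<in> indep R X" for S
      using that unfolding R_def X_def by (rule card_indep_set_cliques_le)
    show "card S \<le> K + 1" if "S \<in> indep Q Y" for S
    proof -
      have "S \<in> indep (circulant b s) {0..<int b}"
        using that by (auto simp: indep_def Q_def Y_def)
      then have "card S * (s + 1) \<le> b" by (rule card_indep_circulant_le[OF \<open>s < b\<close>])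
      also have "b \<le> (K + 1) * (s + 1)"
      proof -
        have "2 * a \<le> K * (t + 1)" by (simp add: a_def K_def algebra_simps)
        then have "b \<le> 2 * s + K * t + K" using b_eq t \<open>t \<le> a\<close> by (simp add: h_def)
        moreover have "2 * (s - t) \<le> K * (s - t)" using P by (intro mult_right_mono) (auto simp: K_def)
        moreover have "K * (s - t) = K * s - K * t" by (simp add: diff_mult_distrib2)
        moreover have "K * t \<le> K * s" using s_ge by (intro mult_left_mono) auto
        ultimately have "b \<le> K * s + K + s + 1" using s_ge by linarith
        then show ?thesis by (simp add: algebra_simps)
      qed
      finally show ?thesis by (simp only: mult_le_cancel2)
    qed
  qed
  obtain G :: "nat pair_pre_digraph"
    where G: "nda_graph (card V) (n + t - 1 - 2 * a) (K + 1) G"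
      and num: "num_indep_sets G = card (indep E V)"
    by (rule nda_graph_nat_copy[OF finV E deg small])
  have "(\<Prod>j<K. sz j + 1) = (\<Prod>j<K. if j < 2 * U then t + 2 else t + 1)"
    by (intro prod.cong) (auto simp: sz_def)
  also have "\<dots> = (t + 2) ^ (2 * U) * (t + 1) ^ (2 * P)"
    by (simp add: prod.If_cases large_small)
  finally have "(t + 1) ^ (2 * P) * (t + 2) ^ (2 * U) = (\<Prod>j<K. sz j + 1)" by (simp only: mult.commute)
  also have "\<dots> \<le> card (indep R X)" unfolding R_def X_def by (rule card_indep_cliques_ge)
  also have "\<dots> \<le> num_indep_sets G"
    unfolding num E_def V_def by (rule card_indep_near_join_ge[OF fin])
  finally show ?thesis using G cV by (auto simp: K_def add_ac)
qed

section \<open>Exponential growth rates\<close>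

text \<open>
  The two cases of the definition of \<open>k\<close> have one common form, with \<open>t\<close> the floor of
  \<open>(1 - c_deg) / c_ind\<close>. Here \<open>p\<close> and \<open>u\<close> are the numbers of cliques of sizes \<open>t\<close> and \<open>t + 1\<close>, divided
  by \<open>n\<close>, when \<open>(1 - c_deg) n\<close> vertices are split as evenly as possible into \<open>c_ind n\<close> cliques.
\<close>

lemma ln_k_const:
  fixes c_deg c_ind :: real
  assumes "0 < c_ind" and "c_ind \<le> 1 - c_deg"
  obtains t :: nat and p u :: real
  where "1 \<le> t" and "p = (real t + 1) * c_ind - (1 - c_deg)" and "u = (1 - c_deg) - real t * c_ind"
    and "0 < p" and "0 \<le> u"
    and "0 < k_const c_ind c_deg"
    and "ln (k_const c_ind c_deg) = p * ln (real t + 1) + u * ln (real t + 2)"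
proof -
  define q where "q = (1 - c_deg) / c_ind"
  define t where "t = nat \<lfloor>q\<rfloor>"
  have q: "1 \<le> q" "c_ind * q = 1 - c_deg" using assms by (auto simp: q_def field_simps)
  have fl: "\<lfloor>q\<rfloor> = int t" and t: "1 \<le> t" using q(1) by (auto simp: t_def le_nat_iff)
  have tq: "real t \<le> q" "q < real t + 1" using fl by linarith+
  define p where "p = (real t + 1) * c_ind - (1 - c_deg)"
  define u where "u = (1 - c_deg) - real t * c_ind"
  have p: "0 < p" and u: "0 \<le> u"
    using tq assms(1) by (auto simp: p_def u_def q_def field_simps)
  have k_eq: "k_const c_ind c_deg = (real t + 1) powr p * (real t + 2) powr u"
  proof (cases "q \<in> \<nat>")
    case True
    then have "q = real t" using fl by (auto elim!: Nats_cases)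
    moreover from this have "u = 0" "p = c_ind" using q(2) by (auto simp: u_def p_def algebra_simps)
    ultimately show ?thesis using True by (simp add: k_const_def q_def[symmetric] add.commute)
  next
    case False
    then have "q \<noteq> real t" by auto
    then have "\<lceil>q\<rceil> = int t + 1" using tq by linarith
    then show ?thesis using False fl
      by (simp add: k_const_def q_def[symmetric] p_def u_def algebra_simps)
  qed
  show ?thesis
  proof (rule that[OF t p_def u_def p u])
    show "0 < k_const c_ind c_deg" by (simp add: k_eq add_nonneg_pos)
    show "ln (k_const c_ind c_deg) = p * ln (real t + 1) + u * ln (real t + 2)"
      by (simp add: k_eq ln_mult ln_powr add_nonneg_pos)
  qed
qed

lemma eventually_along: "eventually P (along N) \<longleftrightarrow> (\<exists>n0. \<forall>n\<ge>n0. n \<in> N \<longrightarrow> P n)"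
  by (simp add: along_def eventually_inf_principal eventually_sequentially)

lemma tendsto_along: "(f \<longlongrightarrow> l) sequentially \<Longrightarrow> (f \<longlongrightarrow> l) (along N)"
  unfolding along_def by (rule tendsto_mono[OF inf_le1])

text \<open>
  A quantity of exponential growth rate \<open>ln k\<close> is literally of the form \<open>k\<^bsup>n (1 + o(1))\<^esup>\<close>: solve for the
  error term.
\<close>

lemma exponent_perturbation:
  fixes B :: "nat \<Rightarrow> real"
  assumes k: "0 < k" "0 < ln k" and B: "\<And>n. n \<in> N \<Longrightarrow> 0 < n \<and> 0 < B n"
    and lim: "((\<lambda>n. ln (B n) / real n) \<longlongrightarrow> ln k) (along N)"
  obtains \<epsilon> where "(\<epsilon> \<longlongrightarrow> 0) (along N)" and "\<And>n. n \<in> N \<Longrightarrow> k powr (real n * (1 + \<epsilon> n)) = B n"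
proof -
  define \<epsilon> where "\<epsilon> n = (ln (B n) / real n) / ln k - 1" for n
  have "(\<epsilon> \<longlongrightarrow> ln k / ln k - 1) (along N)"
    unfolding \<epsilon>_def using k(2) by (intro tendsto_intros lim) auto
  then have "(\<epsilon> \<longlongrightarrow> 0) (along N)" using k(2) by simp
  moreover have "k powr (real n * (1 + \<epsilon> n)) = B n" if "n \<in> N" for n
  proof -
    have "k powr (real n * (1 + \<epsilon> n)) = exp (ln (B n))"
      using k B[OF that] by (simp add: powr_def \<epsilon>_def)
    then show ?thesis using B[OF that] by simp
  qed
  ultimately show ?thesis by (rule that)
qed

lemma tendsto_ratio_along:
  assumes "\<And>n. n \<in> N \<Longrightarrow> \<bar>f n - c * real n\<bar> \<le> C"
  shows "((\<lambda>n. f n / real n) \<longlongrightarrow> c) (along N)"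
proof -
  have "((\<lambda>n. f n / real n - c) \<longlongrightarrow> 0) (along N)"
  proof (rule tendsto_0_le)
    show "\<forall>\<^sub>F n in along N. norm (f n / real n - c) \<le> norm (1 / real n) * C"
      unfolding eventually_along
    proof (intro exI[of _ 1] allI impI)
      fix n :: nat assume n: "1 \<le> n" "n \<in> N"
      then have "f n / real n - c = (f n - c * real n) / real n" by (simp add: field_simps)
      then show "norm (f n / real n - c) \<le> norm (1 / real n) * C"
        using assms[OF n(2)] n(1) by (simp add: abs_divide divide_right_mono)
    qed
    show "((\<lambda>n. 1 / real n) \<longlongrightarrow> 0) (along N)"
      by (rule tendsto_along[OF lim_1_over_n])
  qed
  then show ?thesis by (simp add: LIM_zero_cancel)
qed

lemma num_indep_sets_le_k_const_powr:
  fixes c_deg c_ind :: real and G :: "nat \<Rightarrow> 'a pair_pre_digraph"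
  assumes "0 < c_ind" and "c_ind \<le> 1 - c_deg"
    and seq: "nda_sequence c_ind c_deg N d \<alpha> G"
  shows "\<exists>\<epsilon> :: nat \<Rightarrow> real. (\<epsilon> \<longlongrightarrow> 0) (along N) \<and>
           (\<forall>n\<in>N. real (num_indep_sets (G n)) \<le> k_const c_ind c_deg powr (real n * (1 + \<epsilon> n)))"
proof -
  obtain t :: nat and p u :: real
    where t: "1 \<le> t" and p_eq: "p = (real t + 1) * c_ind - (1 - c_deg)"
      and u_eq: "u = (1 - c_deg) - real t * c_ind"
      and p: "0 < p" and u: "0 \<le> u" and k: "0 < k_const c_ind c_deg"
      and lnk: "ln (k_const c_ind c_deg) = p * ln (real t + 1) + u * ln (real t + 2)"
    by (rule ln_k_const[OF assms(1,2)])
  have lnk_pos: "0 < ln (k_const c_ind c_deg)"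
    unfolding lnk using p u t by (intro add_pos_nonneg) auto
  \<comment> \<open>The line \<open>s \<mapsto> ln A + s * ln x\<close> is the chord through \<open>s = t\<close> and \<open>s = t + 1\<close> of \<open>ln (s + 1)\<close>.
      At the average clique size \<open>(1 - c_deg) / c_ind\<close>, which lies between \<open>t\<close> and \<open>t + 1\<close>, it
      gives exactly \<open>ln k / c_ind\<close>.\<close>
  define x where "x = (real t + 2) / (real t + 1)"
  define A where "A = (real t + 1) / x ^ t"
  have x: "1 \<le> x" by (simp add: x_def field_simps)
  have A: "0 < A" using x by (simp add: A_def)
  have lnx: "ln x = ln (real t + 2) - ln (real t + 1)" by (simp add: x_def ln_div)
  have lnA: "ln A = ln (real t + 1) - real t * ln x"
    using x by (simp add: A_def ln_div ln_realpow)
  \<comment> \<open>The factor \<open>2 n\<close> stands for the polynomial factor \<open>n + 1\<close>.\<close>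
  define B where "B n = (2 * real n) * (A ^ \<alpha> n * x ^ (n - d n))" for n
  have npos: "0 < n" if "n \<in> N" for n using seq that by (simp add: nda_sequence_def)
  have lim_d: "((\<lambda>n. real (d n) / real n) \<longlongrightarrow> c_deg) (along N)"
    and lim_\<alpha>: "((\<lambda>n. real (\<alpha> n) / real n) \<longlongrightarrow> c_ind) (along N)"
    using seq by (simp_all add: nda_sequence_def)
  have ev: "\<forall>\<^sub>F n in along N. ln 2 * (1 / real n) + ln (real n) / real n
        + real (\<alpha> n) / real n * ln A + (1 - real (d n) / real n) * ln x = ln (B n) / real n"
  proof -
    have "\<forall>\<^sub>F n in along N. real (d n) / real n < 1"
      using assms(1,2) by (intro order_tendstoD(2)[OF lim_d]) simp
    moreover have "\<forall>\<^sub>F n in along N. n \<in> N" by (auto simp: eventually_along)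
    ultimately show ?thesis
    proof eventually_elim
      case (elim n)
      then have "0 < n" "d n < n" using npos by (auto simp: field_simps)
      then have "ln (B n) = ln 2 + ln (real n) + real (\<alpha> n) * ln A + (real n - real (d n)) * ln x"
        using x A by (simp add: B_def ln_mult ln_realpow of_nat_diff)
      moreover have "1 - real (d n) / real n = (real n - real (d n)) / real n"
        using \<open>0 < n\<close> by (simp add: diff_divide_distrib)
      ultimately show ?case by (simp add: add_divide_distrib)
    qed
  qed
  have "((\<lambda>n. ln 2 * (1 / real n) + ln (real n) / real n
        + real (\<alpha> n) / real n * ln A + (1 - real (d n) / real n) * ln x)
        \<longlongrightarrow> ln 2 * 0 + 0 + c_ind * ln A + (1 - c_deg) * ln x) (along N)"
    by (intro tendsto_intros lim_d lim_\<alpha> tendsto_along lim_1_over_n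
        filterlim_compose[OF ln_x_over_x_tendsto_0 filterlim_real_sequentially])
  also have "ln 2 * 0 + 0 + c_ind * ln A + (1 - c_deg) * ln x = ln (k_const c_ind c_deg)"
    by (simp add: lnk lnA lnx p_eq u_eq algebra_simps)
  finally have "((\<lambda>n. ln (B n) / real n) \<longlongrightarrow> ln (k_const c_ind c_deg)) (along N)"
    by (rule Lim_transform_eventually[OF _ ev])
  then obtain \<epsilon> where \<epsilon>: "(\<epsilon> \<longlongrightarrow> 0) (along N)"
    and \<epsilon>_eq: "\<And>n. n \<in> N \<Longrightarrow> k_const c_ind c_deg powr (real n * (1 + \<epsilon> n)) = B n"
    using exponent_perturbation[OF k lnk_pos, of N B] npos A x by (auto simp: B_def)
  have "real (num_indep_sets (G n)) \<le> B n" if "n \<in> N" for n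
  proof -
    have "nda_graph n (d n) (\<alpha> n) (G n)" using seq that by (simp add: nda_sequence_def)
    then have "real (num_indep_sets (G n)) \<le> (real n + 1) * (A ^ \<alpha> n * x ^ (n - d n))"
      using x chord_bound unfolding A_def x_def by (intro num_indep_sets_le) auto
    also have "\<dots> \<le> B n"
      unfolding B_def using npos[OF that] x A by (intro mult_right_mono) auto
    finally show ?thesis .
  qed
  then show ?thesis using \<epsilon> \<epsilon>_eq by metis
qed

text \<open>
  The extremal graph with \<open>2 P\<close> close to \<open>p n\<close> and \<open>2 U\<close> close to \<open>u n\<close>. The clique side then has about
  \<open>(t p + (t + 1) u) n = (1 - c_deg) n\<close> vertices in about \<open>(p + u) n = c_ind n\<close> cliques, which gives the two
  limits, and the product of the clique counts has growth rate \<open>ln k\<close>. Rounding changes only the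
  bounded error terms.
\<close>

lemma ex_nda_sequence_ge_k_const_powr:
  fixes c_deg c_ind :: real
  assumes "1/2 \<le> c_deg" and "0 < c_ind" and "c_ind \<le> 1 - c_deg"
  shows "\<exists>(N :: nat set) (d :: nat \<Rightarrow> nat) (\<alpha> :: nat \<Rightarrow> nat) (G :: nat \<Rightarrow> nat pair_pre_digraph).
        nda_sequence c_ind c_deg N d \<alpha> G \<and>
        (\<exists>\<epsilon> :: nat \<Rightarrow> real. (\<epsilon> \<longlongrightarrow> 0) (along N) \<and>
           (\<forall>n\<in>N. real (num_indep_sets (G n)) \<ge> k_const c_ind c_deg powr (real n * (1 + \<epsilon> n))))"
proof -
  obtain t :: nat and p u :: real
    where t: "1 \<le> t" and p_eq: "p = (real t + 1) * c_ind - (1 - c_deg)"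
      and u_eq: "u = (1 - c_deg) - real t * c_ind"
      and p: "0 < p" and u: "0 \<le> u" and k: "0 < k_const c_ind c_deg"
      and lnk: "ln (k_const c_ind c_deg) = p * ln (real t + 1) + u * ln (real t + 2)"
    by (rule ln_k_const[OF assms(2,3)])
  have lnk_pos: "0 < ln (k_const c_ind c_deg)"
    unfolding lnk using p u t by (intro add_pos_nonneg) auto
  define N where "N = {n. 0 < n \<and> even (n + t + 1) \<and> 6 \<le> p * real n}"
  \<comment> \<open>The subtraction of 2 loses nothing in the limit and leaves room for the circulant to have
      degree at least \<open>4 t\<close>, even when \<open>c_deg = 1/2\<close>; \<open>6 \<le> p n\<close> keeps \<open>P n\<close> positive.\<close>
  define P where "P n = nat \<lfloor>p * real n / 2\<rfloor> - 2" for n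
  define U where "U n = nat \<lfloor>u * real n / 2\<rfloor>" for n
  define a where "a n = P n * t + U n * (t + 1)" for n
  define d where "d n = n + t - 1 - 2 * a n" for n
  define \<alpha> where "\<alpha> n = 2 * P n + 2 * U n + 1" for n
  have "infinite N"
    unfolding infinite_nat_iff_unbounded
  proof
    fix m :: nat
    obtain M :: nat where M: "6 / p \<le> real M" using real_arch_simple by blast
    define n where "n = 2 * (m + M) + t + 1"
    have "6 \<le> p * real M" using M p by (simp add: field_simps)
    also have "\<dots> \<le> p * real n" using p by (intro mult_left_mono) (auto simp: n_def)
    finally have "n \<in> N" by (simp add: N_def n_def)
    moreover have "m < n" by (simp add: n_def)
    ultimately show "\<exists>n>m. n \<in> N" by blast
  qed
  have P: "1 \<le> P n" "real (P n) \<le> p / 2 * real n - 2" "p / 2 * real n - 3 \<le> real (P n)" if "n \<in> N" for n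
  proof -
    have "3 \<le> p * real n / 2" using that by (simp add: N_def)
    then have "3 \<le> nat \<lfloor>p * real n / 2\<rfloor>" by (simp add: le_nat_iff le_floor_iff)
    moreover from this have "real (P n) = of_int \<lfloor>p * real n / 2\<rfloor> - 2" unfolding P_def by linarith
    ultimately show "1 \<le> P n" "real (P n) \<le> p / 2 * real n - 2" "p / 2 * real n - 3 \<le> real (P n)"
      unfolding P_def by linarith+
  qed
  have U: "real (U n) \<le> u / 2 * real n" "u / 2 * real n - 1 \<le> real (U n)" for n
  proof -
    have "0 \<le> u * real n / 2" using u by simp
    then have "real (U n) = of_int \<lfloor>u * real n / 2\<rfloor>" unfolding U_def by simp
    then show "real (U n) \<le> u / 2 * real n" "u / 2 * real n - 1 \<le> real (U n)" by linarith+
  qed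
  have room: "4 * a n + 3 * t + 1 \<le> n" if n: "n \<in> N" for n
  proof -
    have "real (a n) = real t * real (P n) + (real t + 1) * real (U n)"
      by (simp add: a_def algebra_simps)
    also have "\<dots> \<le> real t * (p / 2 * real n - 2) + (real t + 1) * (u / 2 * real n)"
      using P[OF n] U by (intro add_mono mult_left_mono) auto
    also have "\<dots> = (1 - c_deg) / 2 * real n - 2 * real t"
      by (simp add: p_eq u_eq field_simps)
    also have "\<dots> \<le> 1 / 4 * real n - 2 * real t"
      using assms(1) by (intro diff_right_mono mult_right_mono) auto
    finally have "real (4 * a n + 8 * t) \<le> real n" by simp
    then have "4 * a n + 8 * t \<le> n" by (simp only: of_nat_le_iff)
    then show ?thesis using t by linarith
  qed
  have limP: "((\<lambda>n. real (P n) / real n) \<longlongrightarrow> p / 2) (along N)"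
  proof (rule tendsto_ratio_along)
    show "\<bar>real (P n) - p / 2 * real n\<bar> \<le> 3" if "n \<in> N" for n using P[OF that] by linarith
  qed
  have limU: "((\<lambda>n. real (U n) / real n) \<longlongrightarrow> u / 2) (along N)"
  proof (rule tendsto_ratio_along)
    show "\<bar>real (U n) - u / 2 * real n\<bar> \<le> 1" for n using U[of n] by linarith
  qed
  have inN: "\<forall>\<^sub>F n in along N. n \<in> N" by (auto simp: eventually_along)
  have lim_d: "((\<lambda>n. real (d n) / real n) \<longlongrightarrow> c_deg) (along N)"
  proof (rule Lim_transform_eventually)
    show "((\<lambda>n. 1 + (real t - 1) * (1 / real n)
        - 2 * (real t * (real (P n) / real n) + (real t + 1) * (real (U n) / real n))) \<longlongrightarrow> c_deg) (along N)"
    proof -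
      have "((\<lambda>n. 1 + (real t - 1) * (1 / real n)
        - 2 * (real t * (real (P n) / real n) + (real t + 1) * (real (U n) / real n)))
        \<longlongrightarrow> 1 + (real t - 1) * 0 - 2 * (real t * (p / 2) + (real t + 1) * (u / 2))) (along N)"
        by (intro tendsto_intros limP limU tendsto_along lim_1_over_n)
      also have "1 + (real t - 1) * 0 - 2 * (real t * (p / 2) + (real t + 1) * (u / 2)) = c_deg"
        by (simp add: p_eq u_eq field_simps)
      finally show ?thesis .
    qed
    show "\<forall>\<^sub>F n in along N. 1 + (real t - 1) * (1 / real n)
        - 2 * (real t * (real (P n) / real n) + (real t + 1) * (real (U n) / real n)) = real (d n) / real n"
      using inN
    proof eventually_elim
      case (elim n)
      then have dn: "real (d n) = real n + real t - 1 - 2 * real (a n)"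
        using room[OF elim] t by (simp add: d_def of_nat_diff)
      have "0 < n" using elim by (simp add: N_def)
      then show ?case
        unfolding dn by (simp add: a_def add_divide_distrib diff_divide_distrib algebra_simps)
    qed
  qed
  have lim_\<alpha>: "((\<lambda>n. real (\<alpha> n) / real n) \<longlongrightarrow> c_ind) (along N)"
  proof -
    have "((\<lambda>n. 2 * (real (P n) / real n) + 2 * (real (U n) / real n) + 1 / real n)
        \<longlongrightarrow> 2 * (p / 2) + 2 * (u / 2) + 0) (along N)"
      by (intro tendsto_intros limP limU tendsto_along lim_1_over_n)
    moreover have "2 * (p / 2) + 2 * (u / 2) + 0 = c_ind" by (simp add: p_eq u_eq field_simps)
    moreover have "2 * (real (P n) / real n) + 2 * (real (U n) / real n) + 1 / real n = real (\<alpha> n) / real n" for n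
      by (simp add: \<alpha>_def add_divide_distrib)
    ultimately show ?thesis by simp
  qed
  define B where "B n = (real t + 1) ^ (2 * P n) * (real t + 2) ^ (2 * U n)" for n
  have "\<exists>G :: nat pair_pre_digraph. nda_graph n (d n) (\<alpha> n) G \<and>
           (t + 1) ^ (2 * P n) * (t + 2) ^ (2 * U n) \<le> num_indep_sets G" if n: "n \<in> N" for n
    using ex_nda_graph_many_indep_sets[OF t P(1)[OF n], of n "U n"] n room[OF n]
    unfolding d_def \<alpha>_def a_def N_def by simp
  then obtain G :: "nat \<Rightarrow> nat pair_pre_digraph" where G: "\<And>n. n \<in> N \<Longrightarrow> nda_graph n (d n) (\<alpha> n) (G n)"
    and num: "\<And>n. n \<in> N \<Longrightarrow> (t + 1) ^ (2 * P n) * (t + 2) ^ (2 * U n) \<le> num_indep_sets (G n)"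
    by metis
  have "0 < d n" if "n \<in> N" for n
    using room[OF that] t that by (simp add: d_def N_def)
  then have seq: "nda_sequence c_ind c_deg N d \<alpha> G"
    using \<open>infinite N\<close> lim_d lim_\<alpha> G by (auto simp: nda_sequence_def N_def \<alpha>_def)
  have "((\<lambda>n. 2 * (real (P n) / real n) * ln (real t + 1) + 2 * (real (U n) / real n) * ln (real t + 2))
      \<longlongrightarrow> 2 * (p / 2) * ln (real t + 1) + 2 * (u / 2) * ln (real t + 2)) (along N)"
    by (intro tendsto_intros limP limU)
  moreover have "2 * (real (P n) / real n) * ln (real t + 1) + 2 * (real (U n) / real n) * ln (real t + 2)
      = ln (B n) / real n" for n
    by (simp add: B_def ln_mult ln_realpow add_nonneg_pos add_divide_distrib)
  ultimately have "((\<lambda>n. ln (B n) / real n) \<longlongrightarrow> ln (k_const c_ind c_deg)) (along N)"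
    by (simp add: lnk)
  then obtain \<epsilon> where \<epsilon>: "(\<epsilon> \<longlongrightarrow> 0) (along N)"
    and \<epsilon>_eq: "\<And>n. n \<in> N \<Longrightarrow> k_const c_ind c_deg powr (real n * (1 + \<epsilon> n)) = B n"
    using exponent_perturbation[OF k lnk_pos, of N B] by (auto simp: B_def N_def add_nonneg_pos)
  have "B n \<le> real (num_indep_sets (G n))" if "n \<in> N" for n
  proof -
    have "B n = real ((t + 1) ^ (2 * P n) * (t + 2) ^ (2 * U n))" by (simp add: B_def add.commute)
    also have "\<dots> \<le> real (num_indep_sets (G n))" using num[OF that] by (simp only: of_nat_le_iff)
    finally show ?thesis .
  qed
  then show ?thesis using seq \<epsilon> \<epsilon>_eq by metis
qed

theorem theorem1p3:
  fixes c_deg c_ind :: real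
  assumes "1/2 \<le> c_deg" and "c_deg < 1" and "0 < c_ind" and "c_ind \<le> 1 - c_deg"
  shows
    "(\<forall>(N :: nat set) (d :: nat \<Rightarrow> nat) (\<alpha> :: nat \<Rightarrow> nat) (G :: nat \<Rightarrow> 'a pair_pre_digraph).
        nda_sequence c_ind c_deg N d \<alpha> G \<longrightarrow>
        (\<exists>\<epsilon> :: nat \<Rightarrow> real. (\<epsilon> \<longlongrightarrow> 0) (along N) \<and>
           (\<forall>n\<in>N. real (num_indep_sets (G n)) \<le> k_const c_ind c_deg powr (real n * (1 + \<epsilon> n)))))
     \<and>
     (\<exists>(N :: nat set) (d :: nat \<Rightarrow> nat) (\<alpha> :: nat \<Rightarrow> nat) (G :: nat \<Rightarrow> nat pair_pre_digraph).
        nda_sequence c_ind c_deg N d \<alpha> G \<and>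
        (\<exists>\<epsilon> :: nat \<Rightarrow> real. (\<epsilon> \<longlongrightarrow> 0) (along N) \<and>
           (\<forall>n\<in>N. real (num_indep_sets (G n)) \<ge> k_const c_ind c_deg powr (real n * (1 + \<epsilon> n)))))"
proof (intro conjI allI impI)
  show "\<exists>\<epsilon>. (\<epsilon> \<longlongrightarrow> 0) (along N) \<and>
      (\<forall>n\<in>N. real (num_indep_sets (G n)) \<le> k_const c_ind c_deg powr (real n * (1 + \<epsilon> n)))"
    if "nda_sequence c_ind c_deg N d \<alpha> G" for N d \<alpha> and G :: "nat \<Rightarrow> 'a pair_pre_digraph"
    by (rule num_indep_sets_le_k_const_powr[OF assms(3,4) that])
qed (rule ex_nda_sequence_ge_k_const_powr[OF assms(1,3,4)])

end
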